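(* For any multiset $M=\{1^{p_1},\ldots,n^{p_n}\}$ we have $$\sum_{T\in \mathcal{T}_M}x_1^{\mathsf{oleaf}(T)}x_2^{\mathsf{yleaf}(T)}y_1^{\mathsf{oint}(T)}y_2^{\mathsf{yint}(T)}=\sum_{T\in \mathcal{A}_{M}}(x_1y_1)^{\mathsf{oleaf}(T)}(x_2+y_2)^{\mathsf{yleaf}(T)},$$ an identity of polynomials in the indeterminates $x_1,x_2,y_1,y_2$.
   Context: A plane tree is a rooted tree in which the children of each node are linearly ordered (from left to right). $M=\{1^{p_1},2^{p_2},\ldots,n^{p_n}\}$ is a multiset in which $i$ has multiplicity $p_i$ ($n\ge1$, all $p_i\ge1$), with cardinality $|M|=p_1+\cdots+p_n$. A weakly increasing tree on $M$ is a plane tree with $|M|+1$ nodes that are labeled precisely by all elements of the multiset $M\cup\{0\}$ such that (i) the labels along a path from the root to any leaf are weakly increasing; (ii) the labels of the children of each node are weakly increasing from right to left. $\mathcal{T}_M$ is the set of weakly increasing trees on $M$. A leaf is a node without children; an internal node is a node with at least one child. A leaf is an old leaf if it is the leftmost child of its parent, and a young leaf otherwise. An old leaf is a singleton leaf if it is the only child of its parent, and an elder leaf if it has siblings. An internal node is an elder internal node if it is the parent of an elder leaf, a singleton internal node if it is the parent of a singleton leaf, and a young internal node otherwise. For $T\in\mathcal{T}_M$: $\mathsf{oleaf}(T)$ is the number of old leaves (singleton leaves plus elder leaves), $\mathsf{yleaf}(T)$ the number of young leaves, $\mathsf{oint}(T)$ the number of singleton internal nodes plus the number of elder internal nodes,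 and $\mathsf{yint}(T)$ the number of young internal nodes. $\mathcal{A}_M$ is the set of tip-augmented weakly increasing trees on $M$, i.e. the trees in $\mathcal{T}_M$ without any young internal node. *)

theory Defs
  imports "HOL-Library.Multiset" "HOL-Library.Poly_Mapping"
begin

section \<open>Labeled plane trees\<close>

text \<open>The list of children is ordered from left to right.\<close>

datatype ptree = Node (label: nat) (children: "ptree list")

primrec labels :: "ptree \<Rightarrow> nat multiset" where
  "labels (Node a ts) = add_mset a (\<Sum>\<^sub># (mset (map labels ts)))"

text \<open>
  A node is identified with its address, the list of child positions (counted from 0, the
  leftmost child) on the way down from the root; the root is \<^term>\<open>[]\<close>, and the children of
  \<^term>\<open>u\<close> are the nodes of the form \<^term>\<open>u @ [i]\<close>.
  The functions \<open>subtree\<close> and \<open>path_labels\<close> are meaningful only at addresses that are nodes.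
\<close>

primrec is_node :: "ptree \<Rightarrow> nat list \<Rightarrow> bool" where
  "is_node T [] \<longleftrightarrow> True"
| "is_node T (i # u) \<longleftrightarrow> i < length (children T) \<and> is_node (children T ! i) u"

definition nodes :: "ptree \<Rightarrow> nat list set" where
  "nodes T = {u. is_node T u}"

primrec subtree :: "ptree \<Rightarrow> nat list \<Rightarrow> ptree" where
  "subtree T [] = T"
| "subtree T (i # u) = subtree (children T ! i) u"

primrec path_labels :: "ptree \<Rightarrow> nat list \<Rightarrow> nat list" where
  "path_labels T [] = [label T]"
| "path_labels T (i # u) = label T # path_labels (children T ! i) u"

definition arity :: "ptree \<Rightarrow> nat list \<Rightarrow> nat" where
  "arity T u = length (children (subtree T u))"


section \<open>Kinds of nodes\<close>

definition leaf :: "ptree \<Rightarrow> nat list \<Rightarrow> bool" where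
  "leaf T u \<longleftrightarrow> u \<in> nodes T \<and> arity T u = 0"

definition internal :: "ptree \<Rightarrow> nat list \<Rightarrow> bool" where
  "internal T u \<longleftrightarrow> u \<in> nodes T \<and> arity T u \<ge> 1"

definition old_leaf :: "ptree \<Rightarrow> nat list \<Rightarrow> bool" where
  "old_leaf T v \<longleftrightarrow> leaf T v \<and> (\<exists>u. v = u @ [0])"

definition young_leaf :: "ptree \<Rightarrow> nat list \<Rightarrow> bool" where
  "young_leaf T v \<longleftrightarrow> leaf T v \<and> \<not> old_leaf T v"

text \<open>The parent of a node \<^term>\<open>v \<noteq> []\<close> is \<^term>\<open>butlast v\<close>.\<close>

definition singleton_leaf :: "ptree \<Rightarrow> nat list \<Rightarrow> bool" where
  "singleton_leaf T v \<longleftrightarrow> old_leaf T v \<and> arity T (butlast v) = 1"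

definition elder_leaf :: "ptree \<Rightarrow> nat list \<Rightarrow> bool" where
  "elder_leaf T v \<longleftrightarrow> old_leaf T v \<and> arity T (butlast v) \<ge> 2"

definition elder_internal :: "ptree \<Rightarrow> nat list \<Rightarrow> bool" where
  "elder_internal T u \<longleftrightarrow> internal T u \<and> (\<exists>i. elder_leaf T (u @ [i]))"

definition singleton_internal :: "ptree \<Rightarrow> nat list \<Rightarrow> bool" where
  "singleton_internal T u \<longleftrightarrow> internal T u \<and> (\<exists>i. singleton_leaf T (u @ [i]))"

definition young_internal :: "ptree \<Rightarrow> nat list \<Rightarrow> bool" where
  "young_internal T u \<longleftrightarrow>
     internal T u \<and> \<not> elder_internal T u \<and> \<not> singleton_internal T u"

definition oleaf :: "ptree \<Rightarrow> nat" where
  "oleaf T = card {v. singleton_leaf T v} + card {v. elder_leaf T v}"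

definition yleaf :: "ptree \<Rightarrow> nat" where
  "yleaf T = card {v. young_leaf T v}"

definition oint :: "ptree \<Rightarrow> nat" where
  "oint T = card {u. singleton_internal T u} + card {u. elder_internal T u}"

definition yint :: "ptree \<Rightarrow> nat" where
  "yint T = card {u. young_internal T u}"


section \<open>Weakly increasing trees on a multiset\<close>

definition wi_trees :: "nat multiset \<Rightarrow> ptree set" where
  "wi_trees M = {T. labels T = add_mset 0 M \<and>
     (\<forall>u. leaf T u \<longrightarrow> sorted (path_labels T u)) \<and>
     (\<forall>u \<in> nodes T. sorted (rev (map label (children (subtree T u)))))}"

definition tip_augmented_trees :: "nat multiset \<Rightarrow> ptree set" where
  "tip_augmented_trees M = {T \<in> wi_trees M. \<not> (\<exists>u. young_internal T u)}"


section \<open>Polynomials in four indeterminates\<close>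

text \<open>
  A polynomial is a finitely supported map from monomials (finitely supported exponent maps) to
  coefficients; multiplication of \<^typ>\<open>'a \<Rightarrow>\<^sub>0 'b\<close> is convolution.
\<close>

datatype indet = X1 | X2 | Y1 | Y2

type_synonym poly4 = "(indet \<Rightarrow>\<^sub>0 nat) \<Rightarrow>\<^sub>0 int"

definition Var :: "indet \<Rightarrow> poly4" where
  "Var v = Poly_Mapping.single (Poly_Mapping.single v 1) 1"


section \<open>Finiteness\<close>

text \<open>The cardinalities and sums over trees above are therefore never degenerate.\<close>

lemma finite_nodes: "finite (nodes T)"
proof (induction T)
  case (Node a ts)
  have "nodes (Node a ts) \<subseteq> insert [] (\<Union>i<length ts. (#) i ` nodes (ts ! i))"
  proof
    fix u assume "u \<in> nodes (Node a ts)"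
    then show "u \<in> insert [] (\<Union>i<length ts. (#) i ` nodes (ts ! i))"
      by (cases u) (auto simp: nodes_def)
  qed
  moreover have "finite (\<Union>i<length ts. (#) i ` nodes (ts ! i))"
    using Node by auto
  ultimately show ?case
    by (meson finite_insert finite_subset)
qed

lemma finite_trees_bounded:
  assumes "finite S"
  shows "finite {T. set_mset (labels T) \<subseteq> S \<and> size (labels T) \<le> k}" (is "finite (?A k)")
proof (induction k)
  case 0
  have "?A 0 = {}"
  proof -
    have "labels T \<noteq> {#}" for T by (cases T) simp
    then show ?thesis by simp
  qed
  then show ?case by (metis finite.emptyI)
next
  case (Suc k)
  have len: "length ts \<le> size (\<Sum>\<^sub># (mset (map labels ts)))" for ts
  proof (induction ts)
    case (Cons t ts)
    have "size (labels t) \<ge> 1" by (cases t) simp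
    with Cons show ?case by simp
  qed simp
  have "?A (Suc k) \<subseteq>
    (\<lambda>(a, ts). Node a ts) ` (S \<times> {ts. set ts \<subseteq> ?A k \<and> length ts \<le> k})"
  proof
    fix T assume T: "T \<in> ?A (Suc k)"
    obtain a ts where [simp]: "T = Node a ts" by (cases T)
    have "t \<in> ?A k" if "t \<in> set ts" for t
    proof -
      have sub: "labels t \<subseteq># \<Sum>\<^sub># (mset (map labels ts))"
        using that by (induction ts) (auto intro: subset_mset.add_increasing subset_mset.add_increasing2)
      then show ?thesis
        using T size_mset_mono[OF sub] set_mset_mono[OF sub] by auto
    qed
    then show "T \<in> (\<lambda>(a, ts). Node a ts) ` (S \<times> {ts. set ts \<subseteq> ?A k \<and> length ts \<le> k})"
      using T len[of ts] by (intro image_eqI[of _ _ "(a, ts)"]) auto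
  qed
  moreover have "finite (S \<times> {ts. set ts \<subseteq> ?A k \<and> length ts \<le> k})"
    using assms finite_lists_length_le[OF Suc] by blast
  ultimately show ?case
    by (meson finite_imageI finite_subset)
qed

lemma finite_wi_trees: "finite (wi_trees M)"
proof -
  have "wi_trees M \<subseteq>
    {T. set_mset (labels T) \<subseteq> set_mset (add_mset 0 M) \<and> size (labels T) \<le> Suc (size M)}"
    by (auto simp: wi_trees_def)
  then show ?thesis
    by (rule finite_subset) (rule finite_trees_bounded, simp)
qed

end

theory Submission
  imports Defs "HOL-Library.Tree_Multiset"
begin

text \<open>
  Reading siblings from right to left turns the first-child/next-sibling encoding of plane forests
  into a bijection between weakly increasing trees on \<open>M\<close> and binary trees on \<open>M\<close> with the heap
  property (\<open>wi_trees_eq_image\<close>): in the binary tree, the left subtree of a node encodes its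
  children, and the right subtree encodes its siblings further to the left. The label of a
  child is at most those of its descendants, and also at most those of its left siblings and their
  descendants; this is the heap condition, which is symmetric in left and right.

  A binary node has an empty left subtree iff the corresponding node is a leaf, and an empty right
  subtree iff it is a leftmost child. Hence old leaves are the nodes without binary children and
  young leaves are the nodes with only a right child. Moreover an internal node is charged to its
  leftmost child: it is elder or singleton if that child is a leaf, so these nodes are equinumerous
  with old leaves, and it is young if that child has only a left binary child. The four statistics
  are therefore the numbers of the three kinds of binary nodes with at most one child
  (\<open>statistics_of_encoding\<close>).

  Now a subtree that is an only child may be moved from the left to the right and back without
  affecting the heap property. Moving all of them to the right (\<open>right_lean\<close>) retracts
  the heaps on \<open>M\<close> onto those without any node having only a left child, which encode the
  tip-augmented trees. In each fibre, every node with a single child chooses a side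
  independently, and so contributes the factor \<open>x\<^sub>2 + y\<^sub>2\<close> (\<open>sum_right_lean_fibre\<close>).
\<close>

section \<open>Statistics in terms of non-root nodes\<close>

text \<open>
  All four statistics count non-root nodes by two features only: whether they are childless,
  and whether they are leftmost children. This makes one recursion serve for all.
\<close>

definition nonroot_nodes :: "(bool \<Rightarrow> bool \<Rightarrow> bool) \<Rightarrow> ptree \<Rightarrow> nat list set" where
  "nonroot_nodes Q T = {v \<in> nodes T. v \<noteq> [] \<and> Q (arity T v = 0) (last v = 0)}"

lemma finite_nonroot_nodes [simp]: "finite (nonroot_nodes Q T)"
  unfolding nonroot_nodes_def using finite_nodes by simp

lemma nodes_snoc_iff: "u @ [i] \<in> nodes T \<longleftrightarrow> u \<in> nodes T \<and> i < arity T u"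
  by (induction u arbitrary: T) (auto simp: nodes_def arity_def)

lemma old_leaf_iff: "old_leaf T v \<longleftrightarrow> v \<in> nonroot_nodes (\<and>) T"
  by (cases v rule: rev_cases) (auto simp: old_leaf_def leaf_def nonroot_nodes_def)

lemma oleaf_eq_card: "oleaf T = card (nonroot_nodes (\<and>) T)"
proof -
  let ?S = "{v. singleton_leaf T v}" and ?E = "{v. elder_leaf T v}"
  have "arity T (butlast v) = 1 \<or> arity T (butlast v) \<ge> 2" if "old_leaf T v" for v
    using that nodes_snoc_iff[of _ 0 T] by (fastforce simp: old_leaf_def leaf_def)
  then have union: "nonroot_nodes (\<and>) T = ?S \<union> ?E"
    by (force simp: singleton_leaf_def elder_leaf_def simp flip: old_leaf_iff)
  then have "finite ?S" "finite ?E"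
    using finite_nonroot_nodes[of "(\<and>)" T] by auto
  then have "card (?S \<union> ?E) = card ?S + card ?E"
    by (intro card_Un_disjoint) (auto simp: singleton_leaf_def elder_leaf_def)
  then show ?thesis
    by (simp add: oleaf_def union)
qed

lemma card_snoc_0:
  assumes "\<And>u. P u \<longleftrightarrow> R (u @ [0::nat])" and "\<And>v. R v \<Longrightarrow> \<exists>u. v = u @ [0]"
  shows "card {u. P u} = card {v. R v}"
proof -
  have "{v. R v} = (\<lambda>u. u @ [0]) ` {u. P u}"
    using assms by auto
  then show ?thesis
    by (simp add: card_image inj_on_def)
qed

text \<open>
  Each of these internal nodes is matched with its leftmost child; the existentially quantified
  child position in the definitions can only be 0, since the child is an old leaf.
\<close>

lemma oint_eq_oleaf: "oint T = oleaf T"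
proof -
  have "card {u. singleton_internal T u} = card {v. singleton_leaf T v}"
  proof (rule card_snoc_0)
    fix u
    show "singleton_internal T u \<longleftrightarrow> singleton_leaf T (u @ [0])"
      by (auto simp: singleton_internal_def internal_def singleton_leaf_def old_leaf_def leaf_def
          nodes_snoc_iff)
  qed (auto simp: singleton_leaf_def old_leaf_def)
  moreover have "card {u. elder_internal T u} = card {v. elder_leaf T v}"
  proof (rule card_snoc_0)
    fix u
    show "elder_internal T u \<longleftrightarrow> elder_leaf T (u @ [0])"
      by (auto simp: elder_internal_def internal_def elder_leaf_def old_leaf_def leaf_def
          nodes_snoc_iff)
  qed (auto simp: elder_leaf_def old_leaf_def)
  ultimately show ?thesis
    by (simp add: oint_def oleaf_def)
qed

text \<open>The root is a leaf only in the one-node tree, and would then be a young leaf.\<close>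

lemma yleaf_eq_card:
  assumes "children T \<noteq> []"
  shows "yleaf T = card (nonroot_nodes (\<lambda>childless leftmost. childless \<and> \<not> leftmost) T)"
proof -
  have "young_leaf T v \<longleftrightarrow> v \<in> nonroot_nodes (\<lambda>childless leftmost. childless \<and> \<not> leftmost) T" for v
    using assms by (cases v rule: rev_cases)
      (auto simp: young_leaf_def old_leaf_def leaf_def nonroot_nodes_def arity_def)
  then show ?thesis
    by (simp add: yleaf_def)
qed

lemma young_internal_iff:
  "young_internal T u \<longleftrightarrow> u @ [0] \<in> nonroot_nodes (\<lambda>childless leftmost. \<not> childless \<and> leftmost) T"
  by (auto simp: young_internal_def internal_def elder_internal_def elder_leaf_def
      singleton_internal_def singleton_leaf_def old_leaf_def leaf_def nonroot_nodes_def
      nodes_snoc_iff)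

lemma yint_eq_card:
  "yint T = card (nonroot_nodes (\<lambda>childless leftmost. \<not> childless \<and> leftmost) T)"
proof -
  have "\<exists>u. v = u @ [0]"
    if "v \<in> nonroot_nodes (\<lambda>childless leftmost. \<not> childless \<and> leftmost) T" for v
    using that by (cases v rule: rev_cases) (auto simp: nonroot_nodes_def)
  then show ?thesis
    unfolding yint_def by (subst card_snoc_0[of "young_internal T", OF young_internal_iff]) auto
qed

lemma young_internal_exists_iff: "(\<exists>u. young_internal T u) \<longleftrightarrow> yint T \<noteq> 0"
proof -
  have "{u. young_internal T u} \<subseteq> nodes T"
    by (auto simp: young_internal_def internal_def)
  then have "finite {u. young_internal T u}"
    using finite_nodes finite_subset by blast
  then show ?thesis
    by (auto simp: yint_def)
qed

section \<open>Encoding plane trees by binary trees\<close>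

primrec forest_of :: "nat tree \<Rightarrow> ptree list" where
  "forest_of \<langle>\<rangle> = []"
| "forest_of \<langle>l, b, r\<rangle> = forest_of r @ [ptree.Node b (forest_of l)]"

lemma forest_of_eq_Nil_iff [simp]: "forest_of t = [] \<longleftrightarrow> t = \<langle>\<rangle>"
  by (cases t) auto

lemma inj_forest_of: "inj forest_of"
proof
  fix s t
  show "forest_of s = forest_of t \<Longrightarrow> s = t"
  proof (induction s arbitrary: t)
    case (Node l b r)
    then show ?case by (cases t) auto
  qed (metis forest_of.simps(1) forest_of_eq_Nil_iff)
qed

lemma surj_forest_of: "\<exists>t. ts = forest_of t"
proof (induction ts rule: measure_induct_rule[where f = "size_list size"])
  case (less ts)
  show ?case
  proof (cases ts rule: rev_cases)
    case Nil
    then show ?thesis by (metis forest_of.simps(1))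
  next
    case (snoc us T)
    obtain b cs where T: "T = ptree.Node b cs" by (cases T)
    have "\<exists>r. us = forest_of r" "\<exists>l. cs = forest_of l"
      using less[of us] less[of cs] by (simp_all add: snoc T)
    then show ?thesis
      by (metis forest_of.simps(2) snoc T)
  qed
qed

lemma labels_forest_of: "labels (ptree.Node a (forest_of t)) = add_mset a (mset_tree t)"
  by (induction t arbitrary: a) auto

definition weakly_increasing :: "ptree \<Rightarrow> bool" where
  "weakly_increasing T \<longleftrightarrow>
     (\<forall>u. leaf T u \<longrightarrow> sorted (path_labels T u)) \<and>
     (\<forall>u \<in> nodes T. sorted (rev (map label (children (subtree T u)))))"

lemma ex_leaf: "\<exists>u. leaf T u"
proof (induction T)
  case (Node a ts)
  show ?case
  proof (cases ts)
    case Nil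
    then have "leaf (ptree.Node a ts) []"
      by (simp add: leaf_def nodes_def arity_def)
    then show ?thesis ..
  next
    case (Cons t us)
    with Node obtain u where "leaf t u" by auto
    with Cons have "leaf (ptree.Node a ts) (0 # u)"
      by (simp add: leaf_def nodes_def arity_def)
    then show ?thesis ..
  qed
qed

lemma path_labels_eq_Cons: "\<exists>xs. path_labels T u = label T # xs"
  by (cases u) auto

lemma sorted_Cons_path_labels:
  "sorted (a # path_labels T u) \<longleftrightarrow> a \<le> label T \<and> sorted (path_labels T u)"
  by (metis path_labels_eq_Cons sorted2)

text \<open>
  The condition on paths from the root becomes one on edges: every child lies on a path to a leaf
  (\<open>ex_leaf\<close>), so its label is compared with that of its parent on some sorted path.
\<close>

lemma weakly_increasing_Node:
  "weakly_increasing (ptree.Node a ts) \<longleftrightarrow>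
     (\<forall>t \<in> set ts. a \<le> label t \<and> weakly_increasing t) \<and> sorted (rev (map label ts))"
proof -
  have leaves: "(\<forall>u. leaf (ptree.Node a ts) u \<longrightarrow> sorted (path_labels (ptree.Node a ts) u)) \<longleftrightarrow>
      (\<forall>t \<in> set ts. \<forall>u. leaf t u \<longrightarrow> sorted (a # path_labels t u))" (is "(\<forall>u. ?P u) \<longleftrightarrow> _")
  proof -
    have "(\<forall>u. ?P u) \<longleftrightarrow> ?P [] \<and> (\<forall>i u. ?P (i # u))"
      by (metis list.exhaust)
    then show ?thesis
      by (auto simp: leaf_def nodes_def arity_def all_set_conv_all_nth)
  qed
  have nodes: "(\<forall>u \<in> nodes (ptree.Node a ts).
        sorted (rev (map label (children (subtree (ptree.Node a ts) u))))) \<longleftrightarrow>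
      sorted (rev (map label ts)) \<and>
      (\<forall>t \<in> set ts. \<forall>u \<in> nodes t. sorted (rev (map label (children (subtree t u)))))"
    (is "(\<forall>u \<in> _. ?P u) \<longleftrightarrow> _")
  proof -
    have "nodes (ptree.Node a ts) = insert [] (\<Union>i<length ts. (#) i ` nodes (ts ! i))"
    proof (rule set_eqI)
      fix u
      show "u \<in> nodes (ptree.Node a ts) \<longleftrightarrow>
          u \<in> insert [] (\<Union>i<length ts. (#) i ` nodes (ts ! i))"
        by (cases u) (auto simp: nodes_def)
    qed
    then show ?thesis
      by (simp add: all_set_conv_all_nth Ball_def[of "{..<_}"])
  qed
  show ?thesis
    unfolding weakly_increasing_def leaves nodes sorted_Cons_path_labels
    using ex_leaf by blast
qed

text \<open>
  The rightmost child has the smallest label among its siblings, so it may replace the parent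
  as a lower bound for the remaining ones.
\<close>

lemma weakly_increasing_snoc:
  "weakly_increasing (ptree.Node a (us @ [ptree.Node b cs])) \<longleftrightarrow>
     a \<le> b \<and> weakly_increasing (ptree.Node b cs) \<and> weakly_increasing (ptree.Node b us)"
  by (subst (1 3) weakly_increasing_Node) (auto intro: order_trans)

lemma weakly_increasing_forest_of_iff:
  "weakly_increasing (ptree.Node a (forest_of t)) \<longleftrightarrow> (\<forall>x \<in> set_tree t. a \<le> x) \<and> heap t"
proof (induction t arbitrary: a)
  case Leaf
  then show ?case by (simp add: weakly_increasing_Node)
next
  case (Node l b r)
  then show ?case by (auto simp: weakly_increasing_snoc)
qed

definition heaps :: "nat multiset \<Rightarrow> nat tree set" where
  "heaps M = {t. heap t \<and> mset_tree t = M}"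

abbreviation plane_tree :: "nat tree \<Rightarrow> ptree" where
  "plane_tree t \<equiv> ptree.Node 0 (forest_of t)"

lemma inj_plane_tree: "inj_on plane_tree A"
  using inj_forest_of by (auto simp: inj_on_def)

lemma wi_trees_eq_image: "wi_trees M = plane_tree ` heaps M"
proof -
  have mem: "T \<in> wi_trees M \<longleftrightarrow> labels T = add_mset 0 M \<and> weakly_increasing T" for T
    by (simp add: wi_trees_def weakly_increasing_def)
  have "T \<in> plane_tree ` heaps M" if T: "T \<in> wi_trees M" for T
  proof -
    obtain a t where aT: "T = ptree.Node a (forest_of t)"
      using surj_forest_of by (metis ptree.exhaust)
    have "weakly_increasing T"
      using T by (simp add: mem)
    then have le: "\<forall>x \<in># labels T. a \<le> x" and t: "heap t"
      by (auto simp: aT weakly_increasing_forest_of_iff labels_forest_of simp del: labels.simps)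
    \<comment> \<open>The label 0 occurs somewhere in the tree, and the root label is the smallest one.\<close>
    have "a = 0"
      using le T by (simp add: mem)
    with T t show ?thesis
      by (auto simp: mem aT labels_forest_of heaps_def simp del: labels.simps)
  qed
  moreover have "plane_tree t \<in> wi_trees M" if "t \<in> heaps M" for t
    using that
    by (simp add: mem heaps_def labels_forest_of weakly_increasing_forest_of_iff
        del: labels.simps)
  ultimately show ?thesis by blast
qed

section \<open>Statistics of the encoding\<close>

primrec count_nodes :: "(bool \<Rightarrow> bool \<Rightarrow> bool) \<Rightarrow> 'a tree \<Rightarrow> nat" where
  "count_nodes Q \<langle>\<rangle> = 0"
| "count_nodes Q \<langle>l, b, r\<rangle> =
     count_nodes Q l + count_nodes Q r + of_bool (Q (l = \<langle>\<rangle>) (r = \<langle>\<rangle>))"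

abbreviation terminal :: "'a tree \<Rightarrow> nat" where
  "terminal \<equiv> count_nodes (\<and>)"

abbreviation only_right :: "'a tree \<Rightarrow> nat" where
  "only_right \<equiv> count_nodes (\<lambda>no_left no_right. no_left \<and> \<not> no_right)"

abbreviation only_left :: "'a tree \<Rightarrow> nat" where
  "only_left \<equiv> count_nodes (\<lambda>no_left no_right. \<not> no_left \<and> no_right)"

lemma nonroot_nodes_Nil: "nonroot_nodes Q (ptree.Node a []) = {}"
proof -
  have "v \<notin> nonroot_nodes Q (ptree.Node a [])" for v
    by (cases v) (auto simp: nonroot_nodes_def nodes_def)
  then show ?thesis by blast
qed

text \<open>
  Appending a tree on the right does not disturb the addresses of the nodes to the left of it,
  and adds the new child itself together with its proper descendants.
\<close>

lemma nonroot_nodes_snoc: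
  "nonroot_nodes Q (ptree.Node a (us @ [ptree.Node b cs])) =
     nonroot_nodes Q (ptree.Node a us) \<union> (#) (length us) ` nonroot_nodes Q (ptree.Node b cs) \<union>
     (if Q (cs = []) (us = []) then {[length us]} else {})" (is "?L = ?A \<union> ?B \<union> ?C")
proof (rule set_eqI)
  fix v
  consider "v = []" | i w where "v = i # w" "i < length us" | w where "v = length us # w"
    | i w where "v = i # w" "i > length us"
    by (metis list.exhaust nat_neq_iff)
  then show "v \<in> ?L \<longleftrightarrow> v \<in> ?A \<union> ?B \<union> ?C"
  proof cases
    case 3
    then show ?thesis
      by (cases w) (auto simp: nonroot_nodes_def nodes_def arity_def)
  qed (auto simp: nonroot_nodes_def nodes_def arity_def nth_append)
qed

lemma card_nonroot_nodes_forest_of: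
  "card (nonroot_nodes Q (ptree.Node a (forest_of t))) = count_nodes Q t"
proof (induction t arbitrary: a)
  case Leaf
  then show ?case by (simp add: nonroot_nodes_Nil)
next
  case (Node l b r)
  let ?k = "length (forest_of r)"
  let ?A = "nonroot_nodes Q (ptree.Node a (forest_of r))"
  let ?B = "nonroot_nodes Q (ptree.Node b (forest_of l))"
  let ?C = "if Q (l = \<langle>\<rangle>) (r = \<langle>\<rangle>) then {[?k]} else {}"
  have "?A \<inter> ((#) ?k ` ?B \<union> ?C) = {}"
    by (auto simp: nonroot_nodes_def nodes_def)
  moreover have "(#) ?k ` ?B \<inter> ?C = {}"
    by (auto simp: nonroot_nodes_def)
  ultimately have "card (?A \<union> ((#) ?k ` ?B \<union> ?C)) = card ?A + card ((#) ?k ` ?B) + card ?C"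
    by (simp add: card_Un_disjoint)
  also have "card ((#) ?k ` ?B) = card ?B"
    by (simp add: card_image)
  finally show ?case
    using Node by (simp add: nonroot_nodes_snoc Un_assoc)
qed

lemma statistics_of_encoding:
  shows "oleaf (plane_tree t) = terminal t"
    and "oint (plane_tree t) = terminal t"
    and "t \<noteq> \<langle>\<rangle> \<Longrightarrow> yleaf (plane_tree t) = only_right t"
    and "yint (plane_tree t) = only_left t"
  by (simp_all add: oint_eq_oleaf oleaf_eq_card yleaf_eq_card yint_eq_card
      card_nonroot_nodes_forest_of)

lemma tip_augmented_trees_eq_image:
  "tip_augmented_trees M = plane_tree ` {t \<in> heaps M. only_left t = 0}"
  unfolding tip_augmented_trees_def wi_trees_eq_image young_internal_exists_iff
  by (auto simp: statistics_of_encoding)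

section \<open>Moving only children to the right\<close>

primrec right_lean :: "'a tree \<Rightarrow> 'a tree" where
  "right_lean \<langle>\<rangle> = \<langle>\<rangle>"
| "right_lean \<langle>l, b, r\<rangle> =
     (if r = \<langle>\<rangle> then \<langle>\<langle>\<rangle>, b, right_lean l\<rangle> else \<langle>right_lean l, b, right_lean r\<rangle>)"

lemma right_lean_eq_Leaf_iff [simp]: "right_lean t = \<langle>\<rangle> \<longleftrightarrow> t = \<langle>\<rangle>"
  by (cases t) auto

lemma mset_tree_right_lean [simp]: "mset_tree (right_lean t) = mset_tree t"
  by (induction t) auto

lemma heap_right_lean_iff [simp]: "heap (right_lean t) \<longleftrightarrow> heap t"
proof -
  have "set_tree (right_lean t) = set_tree t" for t :: "'a tree"
    by (metis mset_tree_right_lean set_mset_tree)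
  then show ?thesis
    by (induction t) auto
qed

lemma only_left_right_lean [simp]: "only_left (right_lean t) = 0"
  by (induction t) auto

definition weight :: "'b \<Rightarrow> 'b \<Rightarrow> 'b \<Rightarrow> 'a tree \<Rightarrow> 'b :: comm_semiring_1" where
  "weight c x y t = c ^ terminal t * x ^ only_right t * y ^ only_left t"

lemma weight_simps:
  "weight c x y \<langle>\<rangle> = 1"
  "weight c x y \<langle>\<langle>\<rangle>, b, \<langle>\<rangle>\<rangle> = c"
  "r \<noteq> \<langle>\<rangle> \<Longrightarrow> weight c x y \<langle>\<langle>\<rangle>, b, r\<rangle> = x * weight c x y r"
  "l \<noteq> \<langle>\<rangle> \<Longrightarrow> weight c x y \<langle>l, b, \<langle>\<rangle>\<rangle> = y * weight c x y l"
  "l \<noteq> \<langle>\<rangle> \<Longrightarrow> r \<noteq> \<langle>\<rangle> \<Longrightarrow> weight c x y \<langle>l, b, r\<rangle> = weight c x y l * weight c x y r"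
  by (simp_all add: weight_def power_add algebra_simps)

lemma right_lean_fibre_Node:
  "{s. right_lean s = \<langle>\<langle>\<rangle>, b, \<langle>\<rangle>\<rangle>} = {\<langle>\<langle>\<rangle>, b, \<langle>\<rangle>\<rangle>}"
  "r \<noteq> \<langle>\<rangle> \<Longrightarrow> {s. right_lean s = \<langle>\<langle>\<rangle>, b, r\<rangle>} =
     (\<lambda>s. \<langle>\<langle>\<rangle>, b, s\<rangle>) ` {s. right_lean s = r} \<union> (\<lambda>s. \<langle>s, b, \<langle>\<rangle>\<rangle>) ` {s. right_lean s = r}"
  "l \<noteq> \<langle>\<rangle> \<Longrightarrow> r \<noteq> \<langle>\<rangle> \<Longrightarrow> {s. right_lean s = \<langle>l, b, r\<rangle>} =
     (\<lambda>(s, s'). \<langle>s, b, s'\<rangle>) ` ({s. right_lean s = l} \<times> {s. right_lean s = r})"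
proof -
  have iff: "right_lean s = \<langle>l, b, r\<rangle> \<longleftrightarrow>
      (\<exists>l' r'. s = \<langle>l', b, r'\<rangle> \<and>
        (r' = \<langle>\<rangle> \<and> l = \<langle>\<rangle> \<and> right_lean l' = r \<or>
         r' \<noteq> \<langle>\<rangle> \<and> right_lean l' = l \<and> right_lean r' = r))"
    for s l b r
    by (cases s) auto
  show "{s. right_lean s = \<langle>\<langle>\<rangle>, b, \<langle>\<rangle>\<rangle>} = {\<langle>\<langle>\<rangle>, b, \<langle>\<rangle>\<rangle>}"
    by (auto simp: iff)
  show "{s. right_lean s = \<langle>\<langle>\<rangle>, b, r\<rangle>} =
     (\<lambda>s. \<langle>\<langle>\<rangle>, b, s\<rangle>) ` {s. right_lean s = r} \<union> (\<lambda>s. \<langle>s, b, \<langle>\<rangle>\<rangle>) ` {s. right_lean s = r}"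
    if "r \<noteq> \<langle>\<rangle>"
    using that by (auto simp: iff)
  show "{s. right_lean s = \<langle>l, b, r\<rangle>} =
     (\<lambda>(s, s'). \<langle>s, b, s'\<rangle>) ` ({s. right_lean s = l} \<times> {s. right_lean s = r})"
    if "l \<noteq> \<langle>\<rangle>" "r \<noteq> \<langle>\<rangle>"
    using that by (auto simp: iff)
qed

text \<open>
  Inside a fibre, a node with a single child has a free choice of side, contributing \<open>x\<close> if that
  child is on the right and \<open>y\<close> if it is on the left. Finiteness is needed to split the sums and
  is part of the induction.
\<close>

lemma sum_right_lean_fibre:
  assumes "only_left t = 0"
  shows "finite {s. right_lean s = t} \<and>
    (\<Sum>s | right_lean s = t. weight c x y s) = c ^ terminal t * (x + y) ^ only_right t"
  using assms
proof (induction t)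
  case Leaf
  have "{s. right_lean s = \<langle>\<rangle>} = {\<langle>\<rangle>}" by auto
  then show ?case by (simp add: weight_simps)
next
  case (Node l b r)
  let ?F = "\<lambda>t. {s :: 'a tree. right_lean s = t}"
  consider "l = \<langle>\<rangle>" "r = \<langle>\<rangle>" | "l = \<langle>\<rangle>" "r \<noteq> \<langle>\<rangle>" | "l \<noteq> \<langle>\<rangle>" "r \<noteq> \<langle>\<rangle>"
    using Node.prems by auto
  then show ?case
  proof cases
    case 1
    then show ?thesis by (simp add: right_lean_fibre_Node weight_simps)
  next
    case 2
    have IH: "finite (?F r)" "sum (weight c x y) (?F r) = c ^ terminal r * (x + y) ^ only_right r"
      using Node by auto
    have nonempty: "s \<noteq> \<langle>\<rangle>" if "s \<in> ?F r" for s
      using that \<open>r \<noteq> \<langle>\<rangle>\<close> by auto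
    have "sum (weight c x y) (?F \<langle>l, b, r\<rangle>) =
        sum (weight c x y) ((\<lambda>s. \<langle>\<langle>\<rangle>, b, s\<rangle>) ` ?F r) +
        sum (weight c x y) ((\<lambda>s. \<langle>s, b, \<langle>\<rangle>\<rangle>) ` ?F r)"
      using 2 IH(1) nonempty by (auto simp: right_lean_fibre_Node intro!: sum.union_disjoint)
    also have "\<dots> = (\<Sum>s \<in> ?F r. x * weight c x y s) + (\<Sum>s \<in> ?F r. y * weight c x y s)"
      using nonempty
      by (simp add: sum.reindex inj_on_def) (intro arg_cong2[of _ _ _ _ "(+)"] sum.cong;
          simp add: weight_simps)
    also have "\<dots> = (x + y) * sum (weight c x y) (?F r)"
      by (simp add: sum_distrib_left distrib_right sum.distrib)
    finally show ?thesis
      using 2 IH by (simp add: right_lean_fibre_Node algebra_simps)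
  next
    case 3
    have IH: "finite (?F l)" "sum (weight c x y) (?F l) = c ^ terminal l * (x + y) ^ only_right l"
      "finite (?F r)" "sum (weight c x y) (?F r) = c ^ terminal r * (x + y) ^ only_right r"
      using Node by auto
    have "sum (weight c x y) (?F \<langle>l, b, r\<rangle>) =
        (\<Sum>(s, s') \<in> ?F l \<times> ?F r. weight c x y \<langle>s, b, s'\<rangle>)"
      using 3 by (simp add: right_lean_fibre_Node sum.reindex inj_on_def case_prod_unfold)
    also have "\<dots> = (\<Sum>(s, s') \<in> ?F l \<times> ?F r. weight c x y s * weight c x y s')"
      using 3 by (intro sum.cong) (auto simp: weight_simps)
    also have "\<dots> = sum (weight c x y) (?F l) * sum (weight c x y) (?F r)"
      by (simp add: sum_product sum.cartesian_product)
    finally show ?thesis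
      using 3 IH by (simp add: right_lean_fibre_Node power_add algebra_simps)
  qed
qed

lemma sum_weight_heaps:
  "(\<Sum>t \<in> heaps M. weight c x y t) =
     (\<Sum>t | t \<in> heaps M \<and> only_left t = 0. c ^ terminal t * (x + y) ^ only_right t)"
proof -
  have fin: "finite (heaps M)"
    using finite_wi_trees[of M] inj_plane_tree by (simp add: wi_trees_eq_image finite_image_iff)
  have "(\<Sum>t \<in> heaps M. weight c x y t) =
      (\<Sum>t | t \<in> heaps M \<and> only_left t = 0.
         \<Sum>s | s \<in> heaps M \<and> right_lean s = t. weight c x y s)"
  proof (rule sum.group[symmetric])
    show "right_lean ` heaps M \<subseteq> {t \<in> heaps M. only_left t = 0}"
      by (auto simp: heaps_def)
  qed (use fin in simp_all)
  also have "\<dots> = (\<Sum>t | t \<in> heaps M \<and> only_left t = 0. c ^ terminal t * (x + y) ^ only_right t)"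
  proof (rule sum.cong)
    fix t assume t: "t \<in> {t \<in> heaps M. only_left t = 0}"
    then have "{s. s \<in> heaps M \<and> right_lean s = t} = {s. right_lean s = t}"
      by (auto simp: heaps_def)
    with t show "(\<Sum>s | s \<in> heaps M \<and> right_lean s = t. weight c x y s) =
        c ^ terminal t * (x + y) ^ only_right t"
      by (simp add: sum_right_lean_fibre)
  qed simp
  finally show ?thesis .
qed

section \<open>The identity\<close>

theorem theorem1p4:
  fixes n :: nat and p :: "nat \<Rightarrow> nat" and M :: "nat multiset"
  assumes "n \<ge> 1"
    and "\<And>i. i \<in> {1..n} \<Longrightarrow> p i \<ge> 1"
    and "M = (\<Sum>i=1..n. replicate_mset (p i) i)"
  shows "(\<Sum>T\<in>wi_trees M.
            Var X1 ^ oleaf T * Var X2 ^ yleaf T * Var Y1 ^ oint T * Var Y2 ^ yint T)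
       = (\<Sum>T\<in>tip_augmented_trees M.
            (Var X1 * Var Y1) ^ oleaf T * (Var X2 + Var Y2) ^ yleaf T)"
proof -
  have "1 \<in># M"
    unfolding assms(3) using assms(1) assms(2)[of 1] by (auto simp: set_mset_sum)
  then have nonempty: "t \<noteq> \<langle>\<rangle>" if "t \<in> heaps M" for t
    using that by (auto simp: heaps_def)
  have "(\<Sum>T\<in>wi_trees M.
            Var X1 ^ oleaf T * Var X2 ^ yleaf T * Var Y1 ^ oint T * Var Y2 ^ yint T) =
      (\<Sum>t \<in> heaps M. weight (Var X1 * Var Y1) (Var X2) (Var Y2) t)"
    unfolding wi_trees_eq_image using nonempty
    by (subst sum.reindex[OF inj_plane_tree], intro sum.cong)
      (simp_all add: statistics_of_encoding weight_def power_mult_distrib mult_ac)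
  also have "\<dots> = (\<Sum>t | t \<in> heaps M \<and> only_left t = 0.
      (Var X1 * Var Y1) ^ terminal t * (Var X2 + Var Y2) ^ only_right t)"
    by (rule sum_weight_heaps)
  also have "\<dots> = (\<Sum>T\<in>tip_augmented_trees M.
            (Var X1 * Var Y1) ^ oleaf T * (Var X2 + Var Y2) ^ yleaf T)"
    unfolding tip_augmented_trees_eq_image using nonempty
    by (subst sum.reindex[OF inj_plane_tree], intro sum.cong)
      (simp_all add: statistics_of_encoding)
  finally show ?thesis .
qed

end
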